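(* Let $\Gamma$ be a finitely generated group with finite generating set $X$. If $\mathrm{F}_{\Gamma,X}(n) \preceq \log\log n$, then $\Gamma$ is finite.
   Context: For a group $\Gamma$ and $g \in \Gamma$ with $g \neq 1$, the normal divisibility function is $\mathrm{D}_\Gamma(g) = \min\{[\Gamma:\Delta] : \Delta \lhd \Gamma,\ g \notin \Delta\}$, where $\Delta$ ranges over normal subgroups of finite index (the value is $\infty$ if no such $\Delta$ exists). For a finite generating set $X$ of $\Gamma$, let $B^\bullet_{\Gamma,X}(n)$ be the set of non-identity elements of $\Gamma$ of word length at most $n$ with respect to $X$, and define $\mathrm{F}_{\Gamma,X}(n) = \max\{\mathrm{D}_\Gamma(g) : g \in B^\bullet_{\Gamma,X}(n)\}$ (a maximum over the empty set is read as $1$). For functions $f,g$, write $f \preceq g$ (or $f(n) \preceq g(n)$) if there exists $C>0$ such that $f(n) \leq C\, g(Cn)$ for all sufficiently large $n$. *)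

theory Defs
  imports "HOL-Algebra.Generated_Groups" "HOL-Library.Extended_Real"
begin

(* The infimum in enat is a minimum for a nonempty set and \<infinity> for the empty set. *)
definition normal_divisibility :: "('a, 'b) monoid_scheme \<Rightarrow> 'a \<Rightarrow> enat" where
  "normal_divisibility G g =
     Inf {enat (card (rcosets\<^bsub>G\<^esub> N)) | N. N \<lhd> G \<and> finite (rcosets\<^bsub>G\<^esub> N) \<and> g \<notin> N}"

(* Words are lists of generators and inverses of generators; elements outside
   the subgroup generated by S get word length \<infinity>. *)
definition word_length :: "('a, 'b) monoid_scheme \<Rightarrow> 'a set \<Rightarrow> 'a \<Rightarrow> enat" where
  "word_length G S g =
     Inf {enat (length w) | w. set w \<subseteq> S \<union> m_inv G ` S \<and>
       foldr (\<otimes>\<^bsub>G\<^esub>) w \<one>\<^bsub>G\<^esub> = g}"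

definition punctured_ball :: "('a, 'b) monoid_scheme \<Rightarrow> 'a set \<Rightarrow> nat \<Rightarrow> 'a set" where
  "punctured_ball G S n = {g \<in> carrier G. g \<noteq> \<one>\<^bsub>G\<^esub> \<and> word_length G S g \<le> enat n}"

(* For finite S the ball is finite, so that Max is a genuine maximum. *)
definition normal_farb_growth :: "('a, 'b) monoid_scheme \<Rightarrow> 'a set \<Rightarrow> nat \<Rightarrow> enat" where
  "normal_farb_growth G S n =
     (if punctured_ball G S n = {} then 1
      else Max (normal_divisibility G ` punctured_ball G S n))"

(* The constant C is real, so the dominating function is taken on the reals. *)
definition growth_dominated :: "(nat \<Rightarrow> ereal) \<Rightarrow> (real \<Rightarrow> ereal) \<Rightarrow> bool" (infix \<open>\<preceq>\<^sub>g\<close> 50) where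
  "f \<preceq>\<^sub>g g \<longleftrightarrow>
     (\<exists>C::real. C > 0 \<and> (\<forall>\<^sub>F n in sequentially. f n \<le> ereal C * g (C * real n)))"

end

theory Submission
  imports Defs "HOL-Algebra.Sylow" "HOL-Algebra.Multiplicative_Group" "HOL-Real_Asymp.Real_Asymp"
begin

text \<open>
  In an infinite group, let \<open>m\<close> be large and let \<open>R\<close> be \<open>m\<close> to the number of normal subgroups of
  index at most \<open>m\<close>, which bounds the index of their intersection. Two of the at least \<open>R + 1\<close>
  elements of the ball of radius \<open>R\<close> agree modulo all these subgroups, and their quotient \<open>g\<close> has
  length at most \<open>2R\<close> and \<open>D(g) > m\<close>. This contradicts the hypothesis once the number of these
  subgroups is shown to be \<open>exp(o(m))\<close>.

  A normal subgroup is determined by the right multiplications by generators on its quotient \<open>Q\<close>.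
  If \<open>H\<close> is a subgroup of \<open>Q\<close> of index \<open>t\<close>, then each of these is described by a map on the \<open>t\<close>
  cosets of \<open>H\<close> and an \<open>H\<close>-valued function on them, so that there are \<open>exp(O(t log m))\<close>
  possibilities once the multiplication of \<open>H\<close> is known. This is good enough if \<open>H\<close> has order at
  least a large multiple \<open>s\<close> of \<open>log m\<close>, provided that there are few multiplications to choose from:
  \<open>H\<close> should be of prime order or of order at most \<open>m powr (1/3)\<close>. A subgroup \<open>H\<close> that is minimal
  among those of order at least \<open>s\<close> satisfies this (a quotient \<open>Q\<close> of order less than \<open>s\<close> is
  harmless). Indeed, suppose that all proper subgroups of \<open>H\<close> have order at most \<open>s\<close> and that the
  order \<open>h\<close> of \<open>H\<close> is neither prime nor at most \<open>s\<^sup>2\<close>; then \<open>H\<close> is not abelian, so its centre has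
  order at most \<open>s\<close>. For a prime \<open>p\<close> dividing \<open>h\<close>, a subgroup of order \<open>p\<close> is central, or its
  normaliser has order at most \<open>s\<close> and hence its conjugates contain at least \<open>(p - 1) h / s\<close>
  elements of order \<open>p\<close>. Summing over \<open>p\<close> shows that the sum of the \<open>p - 1\<close> is at most \<open>2s\<close>, so \<open>h\<close>
  has \<open>O(sqrt s)\<close> prime divisors; as Sylow subgroups have order at most \<open>s\<close>, this gives
  \<open>h \<le> exp(O(sqrt s log s))\<close>.
\<close>

section \<open>Finite groups with small proper subgroups\<close>

lemma card_le_fibre_bound:
  assumes "finite A" "finite B" "f ` A \<subseteq> B"
    and "\<And>a. a \<in> A \<Longrightarrow> card {x \<in> A. f x = f a} \<le> n"
  shows "card A \<le> n * card B"
proof -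
  have "A = (\<Union>b\<in>f ` A. {x \<in> A. f x = b})" by auto
  then have "card A \<le> (\<Sum>b\<in>f ` A. card {x \<in> A. f x = b})"
    using card_UN_le[of "f ` A" "\<lambda>b. {x \<in> A. f x = b}"] assms(1) by simp
  also have "\<dots> \<le> (\<Sum>b\<in>f ` A. n)"
    using assms(4) by (intro sum_mono) auto
  also have "\<dots> \<le> n * card B"
    using card_mono[OF assms(2,3)] by simp
  finally show ?thesis .
qed

text \<open>A maximum of \<open>card A\<close> distinct positive integers is at least
  \<open>card A\<close>, so removing it gives an induction. Applied to the numbers
  \<open>p - 1\<close>, this turns a bound on their sum into one on the number of prime
  divisors.\<close>

lemma sum_ge_triangular:
  fixes A :: "nat set"
  assumes "finite A" "0 \<notin> A"
  shows "card A * (card A + 1) \<le> 2 * \<Sum>A"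
  using assms
proof (induction "card A" arbitrary: A)
  case 0
  then show ?case by simp
next
  case (Suc n)
  let ?M = "Max A"
  have ne: "A \<noteq> {}" using Suc.hyps(2) by auto
  have M: "?M \<in> A" using ne Suc.prems by simp
  have cA: "card (A - {?M}) = n" using M Suc.hyps(2) Suc.prems by simp
  have IH: "n * (n + 1) \<le> 2 * \<Sum>(A - {?M})"
    using Suc.hyps(1)[of "A - {?M}"] cA Suc.prems by auto
  have "A \<subseteq> {1..?M}"
  proof
    fix x assume "x \<in> A"
    then have "x \<noteq> 0" "x \<le> ?M" using Suc.prems by (auto intro: ccontr)
    then show "x \<in> {1..?M}" by simp
  qed
  then have "card A \<le> ?M" using card_mono[of "{1..?M}" A] by simp
  moreover have "\<Sum>A = ?M + \<Sum>(A - {?M})" using M Suc.prems by (simp add: sum.remove)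
  ultimately show ?case using IH Suc.hyps(2)[symmetric] by (simp add: algebra_simps)
qed

section \<open>Elements of prime order and conjugation\<close>

context group
begin

lemma card_subgroup_Int_dvd:
  assumes "subgroup P G" "subgroup K G" "finite (carrier G)"
  shows "card (P \<inter> K) dvd card P"
proof -
  interpret P: group "G\<lparr>carrier := P\<rparr>" by (rule subgroup_imp_group[OF assms(1)])
  have "subgroup (P \<inter> K) (G\<lparr>carrier := P\<rparr>)"
    using assms subgroups_Inter_pair subgroup_incl by auto
  from P.lagrange[OF this] have "card (rcosets\<^bsub>G\<lparr>carrier := P\<rparr>\<^esub> (P \<inter> K)) * card (P \<inter> K) = card P"
    by (simp add: order_def)
  then show ?thesis by (metis dvd_triv_right)
qed

text \<open>By Lagrange \<open>P \<inter> K\<close> has order \<open>1\<close> or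
  \<open>card P\<close>, and \<open>y\<close> excludes the former. Consequently conjugates of
  \<open>P\<close> that share a nontrivial element coincide.\<close>

lemma prime_subgroup_subset:
  assumes P: "subgroup P G" "prime (card P)" and K: "subgroup K G" and "finite (carrier G)"
    and "y \<in> P" "y \<in> K" "y \<noteq> \<one>"
  shows "P \<subseteq> K"
proof -
  have fP: "finite P" using P assms(4) by (meson finite_subset subgroup.subset)
  have "{\<one>, y} \<subseteq> P \<inter> K" using assms subgroup.one_closed by auto
  then have "card {\<one>, y} \<le> card (P \<inter> K)" using fP by (intro card_mono) auto
  moreover have "card {\<one>, y} = 2" using assms(7) by simp
  ultimately have "card (P \<inter> K) \<noteq> 1" by simp
  then have "card (P \<inter> K) = card P"
    using card_subgroup_Int_dvd[OF P(1) K assms(4)] P(2) by (auto simp: prime_nat_iff)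
  then have "P \<inter> K = P" using fP by (intro card_subset_eq) auto
  then show ?thesis by blast
qed

lemma pow_card_subgroup:
  assumes "subgroup P G" "finite (carrier G)" "y \<in> P"
  shows "y [^] card P = \<one>"
proof -
  interpret P: group "G\<lparr>carrier := P\<rparr>" by (rule subgroup_imp_group[OF assms(1)])
  have "y [^]\<^bsub>G\<lparr>carrier := P\<rparr>\<^esub> order (G\<lparr>carrier := P\<rparr>) = \<one>"
    using P.pow_order_eq_1 assms by simp
  then show ?thesis by (simp add: order_def nat_pow_def)
qed

text \<open>For prime \<open>p\<close> these are the elements of order exactly \<open>p\<close>;
  leaving out the identity makes the sets for different primes disjoint.\<close>

definition p_torsion :: "nat \<Rightarrow> 'a set" where
  "p_torsion p = {y \<in> carrier G. y \<noteq> \<one> \<and> y [^] p = \<one>}"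

lemma p_torsion_disjoint:
  assumes "prime p" "prime q" "p \<noteq> q"
  shows "p_torsion p \<inter> p_torsion q = {}"
proof -
  have "y = \<one>" if "y \<in> carrier G" "y [^] p = \<one>" "y [^] q = \<one>" for y
  proof -
    have "coprime p q" using assms primes_coprime by blast
    then have "ord y dvd 1"
      using that by (metis coprime_common_divisor pow_eq_id)
    then show ?thesis using that(1) by (metis ord_eq_1 nat_dvd_1_iff_1)
  qed
  then show ?thesis unfolding p_torsion_def by blast
qed

lemma prime_subgroup_torsion:
  assumes "subgroup P G" "finite (carrier G)"
  shows "P - {\<one>} \<subseteq> p_torsion (card P)"
  using pow_card_subgroup[OF assms] subgroup.subset[OF assms(1)] unfolding p_torsion_def by auto

definition conj_by :: "'a \<Rightarrow> 'a \<Rightarrow> 'a" where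
  "conj_by g y = g \<otimes> y \<otimes> inv g"

lemma conj_by_closed [simp]: "\<lbrakk>g \<in> carrier G; y \<in> carrier G\<rbrakk> \<Longrightarrow> conj_by g y \<in> carrier G"
  by (simp add: conj_by_def)

lemma conj_by_mult: "\<lbrakk>g \<in> carrier G; k \<in> carrier G; y \<in> carrier G\<rbrakk> \<Longrightarrow> conj_by (g \<otimes> k) y = conj_by g (conj_by k y)"
  by (simp add: conj_by_def inv_mult_group m_assoc)

lemma conj_by_one [simp]: "y \<in> carrier G \<Longrightarrow> conj_by \<one> y = y"
  by (simp add: conj_by_def)

lemma conj_by_mult_right: "\<lbrakk>g \<in> carrier G; x \<in> carrier G; y \<in> carrier G\<rbrakk> \<Longrightarrow> conj_by g (x \<otimes> y) = conj_by g x \<otimes> conj_by g y"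
  unfolding conj_by_def by (simp add: m_assoc inv_solve_left)
    
lemma conj_by_inv [simp]: "\<lbrakk>g \<in> carrier G; y \<in> carrier G\<rbrakk> \<Longrightarrow> conj_by (inv g) (conj_by g y) = y"
  using conj_by_mult[of "inv g" g y] by simp

lemma conj_by_hom: "g \<in> carrier G \<Longrightarrow> group_hom G G (conj_by g)"
  by unfold_locales (auto simp: hom_def conj_by_mult_right)

lemma conj_by_eq_one_iff: "\<lbrakk>g \<in> carrier G; y \<in> carrier G\<rbrakk> \<Longrightarrow> conj_by g y = \<one> \<longleftrightarrow> y = \<one>"
  by (metis conj_by_hom conj_by_inv group_hom.hom_one inv_closed)

lemma conj_by_inj_on: "g \<in> carrier G \<Longrightarrow> inj_on (conj_by g) (carrier G)"
  by (metis conj_by_inv inj_onI)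

lemma subgroup_conj_by: "\<lbrakk>subgroup P G; g \<in> carrier G\<rbrakk> \<Longrightarrow> subgroup (conj_by g ` P) G"
  by (rule group_hom.subgroup_img_is_subgroup[OF conj_by_hom])

lemma subgroup_conj_stabiliser:
  assumes "P \<subseteq> carrier G"
  shows "subgroup {g \<in> carrier G. conj_by g ` P = P} G"
proof (rule subgroupI)
  have "conj_by \<one> ` P = id ` P" using assms by (intro image_cong) auto
  then show "{g \<in> carrier G. conj_by g ` P = P} \<noteq> {}" by auto
next
  fix a assume a: "a \<in> {g \<in> carrier G. conj_by g ` P = P}"
  then have "conj_by (inv a) ` P = conj_by (inv a) ` (conj_by a ` P)" by simp
  also have "\<dots> = id ` P" unfolding image_image using a assms by (intro image_cong) auto
  finally show "inv a \<in> {g \<in> carrier G. conj_by g ` P = P}" using a by simp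
next
  fix a b assume a: "a \<in> {g \<in> carrier G. conj_by g ` P = P}"
    and b: "b \<in> {g \<in> carrier G. conj_by g ` P = P}"
  have "conj_by (a \<otimes> b) ` P = conj_by a ` (conj_by b ` P)"
    unfolding image_image using a b assms by (intro image_cong) (auto simp: conj_by_mult)
  then show "a \<otimes> b \<in> {g \<in> carrier G. conj_by g ` P = P}" using a b by simp
qed auto

text \<open>Double counting along \<open>(g, y) \<mapsto> conj_by g y\<close> on
  \<open>carrier G \<times> (P - {\<one>})\<close>: all values have order \<open>card P\<close>, and
  each fibre embeds into the normaliser of \<open>P\<close>.\<close>

lemma card_fibre_conj_torsion:
  assumes fin: "finite (carrier G)" and P: "subgroup P G" "prime (card P)"
  shows "card (carrier G) * (card P - 1)
    \<le> card {g \<in> carrier G. conj_by g ` P = P} * card (p_torsion (card P))"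
proof -
  let ?N = "{g \<in> carrier G. conj_by g ` P = P}"
  let ?A = "carrier G \<times> (P - {\<one>})"
  have PG: "P \<subseteq> carrier G" by (rule subgroup.subset[OF P(1)])
  have fP: "finite P" using fin PG finite_subset by blast
  have "card ?A \<le> card ?N * card (p_torsion (card P))"
  proof (rule card_le_fibre_bound[where f = "\<lambda>(g, y). conj_by g y"])
    show "finite ?A" using fin fP by simp
    show "finite (p_torsion (card P))" using fin by (simp add: p_torsion_def)
    show "(\<lambda>(g, y). conj_by g y) ` ?A \<subseteq> p_torsion (card P)"
    proof
      fix w assume "w \<in> (\<lambda>(g, y). conj_by g y) ` ?A"
      then obtain g y where w: "w = conj_by g y" and *: "g \<in> carrier G" "y \<in> P" "y \<noteq> \<one>"
        by auto
      then have y: "y \<in> carrier G" using PG by blast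
      have "conj_by g y \<in> conj_by g ` P - {\<one>}"
        using * y conj_by_eq_one_iff by simp
      moreover have "card (conj_by g ` P) = card P"
        using card_image inj_on_subset[OF conj_by_inj_on PG] * by blast
      ultimately show "w \<in> p_torsion (card P)"
        unfolding w using prime_subgroup_torsion[OF subgroup_conj_by[OF P(1) *(1)] fin] by (metis subsetD)
    qed
  next
    fix a assume "a \<in> ?A"
    then obtain g y where a: "a = (g, y)" and g: "g \<in> carrier G" and y: "y \<in> P" "y \<noteq> \<one>" by blast
    let ?F = "{x \<in> ?A. (case x of (g, y) \<Rightarrow> conj_by g y) = (case a of (g, y) \<Rightarrow> conj_by g y)}"
    have *: "h \<in> carrier G \<and> z \<in> P \<and> inv g \<otimes> h \<in> ?N \<and> z = conj_by (inv h) (conj_by g y)"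
      if "(h, z) \<in> ?F" for h z
    proof -
      have h: "h \<in> carrier G" and z: "z \<in> P" "z \<noteq> \<one>" and e: "conj_by h z = conj_by g y"
        using that a by auto
      have zG: "z \<in> carrier G" and yG: "y \<in> carrier G" using z y PG by auto
      \<comment> \<open>Conjugation by \<open>?k\<close> takes \<open>z\<close> to \<open>y\<close>,
        so \<open>P\<close> and its conjugate by \<open>?k\<close> share the nontrivial element
        \<open>y\<close> and are equal: \<open>?k\<close> normalises \<open>P\<close>.\<close>
      let ?k = "inv g \<otimes> h"
      have k: "?k \<in> carrier G" using g h by simp
      have "conj_by ?k z = y" using g h zG yG by (simp add: conj_by_mult e)
      then have "y \<in> conj_by ?k ` P" using z by blast
      then have sub: "P \<subseteq> conj_by ?k ` P"
        using prime_subgroup_subset[OF P subgroup_conj_by[OF P(1) k] fin y(1) _ y(2)] by blast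
      have "card (conj_by ?k ` P) = card P"
        using card_image inj_on_subset[OF conj_by_inj_on PG] k by blast
      then have "conj_by ?k ` P = P" using sub fP by (metis card_subset_eq finite_imageI)
      moreover have "z = conj_by (inv h) (conj_by g y)" using h zG e[symmetric] by simp
      ultimately show ?thesis using h z k by simp
    qed
    have "inj_on (\<lambda>(h, z). inv g \<otimes> h) ?F"
    proof (rule inj_onI)
      fix u v assume u: "u \<in> ?F" and v: "v \<in> ?F"
        and e: "(\<lambda>(h, z). inv g \<otimes> h) u = (\<lambda>(h, z). inv g \<otimes> h) v"
      obtain h z h' z' where uv: "u = (h, z)" "v = (h', z')" by (metis surj_pair)
      note 1 = *[OF u[unfolded uv]] and 2 = *[OF v[unfolded uv]]
      have "inv g \<otimes> h = inv g \<otimes> h'" using e uv by simp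
      then have h: "h = h'" using 1 2 g by simp
      then have "z = z'" using conjunct2[OF conjunct2[OF conjunct2[OF 1]]]
          conjunct2[OF conjunct2[OF conjunct2[OF 2]]] by (rule_tac trans) (simp_all only:)
      then show "u = v" using h uv by (simp only:)
    qed
    moreover have "(\<lambda>(h, z). inv g \<otimes> h) ` ?F \<subseteq> ?N" using * by auto
    ultimately show "card ?F \<le> card ?N" using fin by (intro card_inj_on_le) auto
  qed
  moreover have "card ?A = card (carrier G) * (card P - 1)"
    using fP subgroup.one_closed[OF P(1)] by (simp add: card_cartesian_product)
  ultimately show ?thesis by simp
qed

section \<open>Centralisers, the centre and bounds on the order\<close>

lemma card_le_hom_fibre:
  assumes "group_hom G G f" "finite (carrier G)"
  shows "card (carrier G) \<le> card (kernel G G f) * card (f ` carrier G)"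
proof (rule card_le_fibre_bound[where f = f])
  interpret group_hom G G f by (rule assms(1))
  show "finite (carrier G)" "finite (f ` carrier G)" using assms by auto
  fix a assume a: "a \<in> carrier G"
  have "inj_on (\<lambda>x. inv a \<otimes> x) {x \<in> carrier G. f x = f a}"
    using a by (auto simp: inj_on_def)
  moreover have "(\<lambda>x. inv a \<otimes> x) ` {x \<in> carrier G. f x = f a} \<subseteq> kernel G G f"
    using a by (auto simp: kernel_def)
  moreover have "finite (kernel G G f)"
    using assms(2) by (simp add: kernel_def)
  ultimately show "card {x \<in> carrier G. f x = f a} \<le> card (kernel G G f)"
    by (intro card_inj_on_le)
qed auto

text \<open>The inequality form of orbit-stabiliser; \<open>P\<close> may be any finite set
  containing the conjugacy class of \<open>x\<close>.\<close>

lemma card_le_centraliser_mult_class: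
  assumes "finite (carrier G)" "x \<in> carrier G" "(\<lambda>g. conj_by g x) ` carrier G \<subseteq> P" "finite P"
  shows "card (carrier G) \<le> card {g \<in> carrier G. conj_by g x = x} * card P"
proof (rule card_le_fibre_bound[where f = "\<lambda>g. conj_by g x"])
  fix a assume a: "a \<in> carrier G"
  let ?F = "{g \<in> carrier G. conj_by g x = conj_by a x}"
  have "inj_on (\<lambda>g. inv a \<otimes> g) ?F"
    using a by (auto simp: inj_on_def)
  moreover have "(\<lambda>g. inv a \<otimes> g) ` ?F \<subseteq> {g \<in> carrier G. conj_by g x = x}"
    using a assms(2) by (auto simp: conj_by_mult)
  ultimately show "card ?F \<le> card {g \<in> carrier G. conj_by g x = x}"
    using assms(1) by (intro card_inj_on_le) auto
qed (use assms in auto)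

lemma subgroup_centraliser:
  assumes "x \<in> carrier G"
  shows "subgroup {g \<in> carrier G. conj_by g x = x} G"
  using subgroup_conj_stabiliser[of "{x}"] assms by simp

definition centre :: "'a set" where
  "centre = {x \<in> carrier G. \<forall>g\<in>carrier G. conj_by g x = x}"

lemma conj_by_eq_iff: "\<lbrakk>g \<in> carrier G; x \<in> carrier G\<rbrakk> \<Longrightarrow> conj_by g x = x \<longleftrightarrow> g \<otimes> x = x \<otimes> g"
  using right_cancel[of "g" "conj_by g x" x] by (simp add: conj_by_def m_assoc)

lemma subgroup_centre: "subgroup centre G"
proof (rule subgroupI)
  have "\<one> \<in> centre" by (simp add: centre_def conj_by_eq_one_iff)
  then show "centre \<noteq> {}" by blast
next
  fix a assume "a \<in> centre"
  then have a: "a \<in> carrier G" "\<And>g. g \<in> carrier G \<Longrightarrow> conj_by g a = a" by (auto simp: centre_def)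
  have "conj_by g (inv a) = inv a" if g: "g \<in> carrier G" for g
    using group_hom.hom_inv[OF conj_by_hom[OF g] a(1)] a(2)[OF g] by simp
  then show "inv a \<in> centre" using a by (simp add: centre_def)
next
  fix a b assume "a \<in> centre" "b \<in> centre"
  then show "a \<otimes> b \<in> centre" by (simp add: centre_def conj_by_mult_right)
qed (simp add: centre_def subset_iff)

text \<open>A Sylow subgroup that is proper has order at most \<open>s\<close>. Otherwise the group
  has order \<open>p ^ a\<close> with \<open>a \<ge> 2\<close>, as the order is not prime, and its
  subgroups of orders \<open>p ^ (a - 1)\<close> and \<open>p\<close> are proper; these orders
  multiply to the order of the group.\<close>

lemma sylow_part_bound:
  assumes fin: "finite (carrier G)" and p: "prime p" "p dvd card (carrier G)"
    and np: "\<not> prime (card (carrier G))"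
    and proper: "\<And>K. subgroup K G \<Longrightarrow> K \<noteq> carrier G \<Longrightarrow> card K \<le> s"
  shows "p ^ multiplicity p (card (carrier G)) \<le> s \<or> card (carrier G) \<le> s * s"
proof -
  let ?h = "card (carrier G)"
  let ?a = "multiplicity p ?h"
  have h0: "?h \<noteq> 0" using fin by auto
  have bound: "p ^ b \<le> s" if "b \<le> ?a" "p ^ b \<noteq> ?h" for b
  proof -
    have "p ^ b dvd ?h" using that(1) by (rule multiplicity_dvd')
    then obtain m where "?h = p ^ b * m" by (rule dvdE)
    then obtain K where K: "subgroup K G" "card K = p ^ b"
      using sylow_thm[OF p(1) is_group _ fin] unfolding order_def by blast
    then show ?thesis using proper[OF K(1)] that(2) by metis
  qed
  show ?thesis
  proof (cases "p ^ ?a = ?h")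
    case True
    have "?a \<noteq> 0" using p h0 multiplicity_eq_zero_iff[of ?h p] not_prime_unit by blast
    moreover have "?a \<noteq> 1" using True p(1) np by (metis power_one_right)
    ultimately obtain b where b: "?a = Suc b" "b \<noteq> 0" by (cases ?a) auto
    have p1: "1 < p" using p(1) prime_gt_1_nat by blast
    have h: "?h = p ^ b * p ^ 1" using True unfolding b(1) by (simp add: mult.commute)
    have "1 < p ^ b" using one_less_power[OF p1] b(2) by (metis neq0_conv)
    then have "p ^ b \<noteq> ?h" "p ^ 1 \<noteq> ?h" using p1 h by auto
    then have "p ^ b \<le> s" "p ^ 1 \<le> s" using bound[of b] bound[of 1] b by auto
    then show ?thesis using h mult_le_mono by metis
  next
    case False
    then show ?thesis using bound by blast
  qed
qed

lemma exists_prime_subgroup: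
  assumes "finite (carrier G)" "prime p" "p dvd card (carrier G)"
  obtains P where "subgroup P G" "card P = p"
proof -
  obtain m where "order G = p ^ 1 * m" using assms(3) by (auto simp: order_def)
  from sylow_thm[OF assms(2) is_group this assms(1)] show ?thesis using that by auto
qed

text \<open>The map \<open>y \<mapsto> y [^] p\<close> is a homomorphism. Its image is proper since
  it kills an element of order \<open>p\<close>. If the order exceeded \<open>s * s\<close>, the
  group would not be a \<open>p\<close>-group, so an element of another prime order \<open>q\<close>
  would lie outside the kernel; image and kernel would both have order at most
  \<open>s\<close>.\<close>

lemma card_le_square_if_comm:
  assumes fin: "finite (carrier G)" and p: "prime p" "p dvd card (carrier G)"
    and np: "\<not> prime (card (carrier G))"
    and proper: "\<And>K. subgroup K G \<Longrightarrow> K \<noteq> carrier G \<Longrightarrow> card K \<le> s"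
    and comm: "\<And>x y. x \<in> carrier G \<Longrightarrow> y \<in> carrier G \<Longrightarrow> x \<otimes> y = y \<otimes> x"
  shows "card (carrier G) \<le> s * s"
proof (rule ccontr)
  let ?h = "card (carrier G)"
  assume big: "\<not> ?h \<le> s * s"
  have h0: "?h \<noteq> 0" using fin by auto
  define f where "f = (\<lambda>y. y [^] p)"
  have f: "group_hom G G f"
    by unfold_locales (auto simp: hom_def f_def pow_mult_distrib comm)
  interpret f: group_hom G G f by (rule f)
  obtain P where P: "subgroup P G" "card P = p" using exists_prime_subgroup[OF fin p] .
  have tP: "P - {\<one>} \<subseteq> p_torsion p" using prime_subgroup_torsion[OF P(1) fin] P(2) by simp
  have "1 < card P" using P p prime_gt_1_nat by blast
  then have "P \<noteq> {\<one>}" by auto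
  then obtain x where x: "x \<in> p_torsion p" using tP subgroup.one_closed[OF P(1)] by blast
  have "\<not> inj_on f (carrier G)"
    using x inj_onD[of f "carrier G" x \<one>] by (auto simp: p_torsion_def f_def)
  then have ni: "f ` carrier G \<noteq> carrier G"
    using fin eq_card_imp_inj_on by metis
  have I: "card (f ` carrier G) \<le> s"
    using proper[OF f.img_is_subgroup ni] .
  have s1: "1 \<le> s" using I fin by (metis One_nat_def Suc_leI card_gt_0_iff carrier_not_empty
      finite_imageI image_is_empty le_trans)
  have "p ^ multiplicity p ?h \<le> s"
    using sylow_part_bound[OF fin p np proper] big by blast
  moreover have "s \<le> s * s" using s1 by simp
  ultimately have ne: "p ^ multiplicity p ?h \<noteq> ?h" using big by linarith
  obtain m where m: "?h = p ^ multiplicity p ?h * m" "\<not> p dvd m"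
    using multiplicity_decompose'[of ?h p] h0 p(1) by (metis not_prime_unit)
  then have "m \<noteq> 1" using ne by auto
  then obtain q where q: "prime q" "q dvd m" using prime_factor_nat by blast
  then have qp: "q \<noteq> p" "q dvd ?h" using m by (auto, metis dvd_mult)
  obtain Q where Q: "subgroup Q G" "card Q = q" using exists_prime_subgroup[OF fin q(1) qp(2)] .
  have tQ: "Q - {\<one>} \<subseteq> p_torsion q" using prime_subgroup_torsion[OF Q(1) fin] Q(2) by simp
  have "1 < card Q" using Q q prime_gt_1_nat by blast
  then have "Q \<noteq> {\<one>}" by auto
  then obtain y where y: "y \<in> p_torsion q" using tQ subgroup.one_closed[OF Q(1)] by blast
  then have "y \<notin> p_torsion p" using p_torsion_disjoint[OF q(1) p(1) qp(1)] by blast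
  then have "y \<notin> kernel G G f" "y \<in> carrier G" using y by (auto simp: p_torsion_def kernel_def f_def)
  then have "kernel G G f \<noteq> carrier G" by blast
  then have "card (kernel G G f) \<le> s" using proper[OF f.subgroup_kernel] by blast
  then have "?h \<le> s * s"
    using card_le_hom_fibre[OF f fin] I mult_le_mono le_trans by blast
  then show False using big by blast
qed

text \<open>Let \<open>P\<close> be a subgroup of order \<open>p\<close>. If it is not normal, its
  normaliser has order at most \<open>s\<close> and the double count gives the first summand. If it
  is normal, classes of its elements stay inside \<open>P\<close>, so their centralisers exceed
  \<open>s\<close> and are everything; \<open>P\<close> is central and gives the second summand.
  Adding both cases allows summation over \<open>p\<close>.\<close>

lemma prime_torsion_bound:
  assumes fin: "finite (carrier G)" and p: "prime p" "p dvd card (carrier G)"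
    and np: "\<not> prime (card (carrier G))"
    and proper: "\<And>K. subgroup K G \<Longrightarrow> K \<noteq> carrier G \<Longrightarrow> card K \<le> s"
    and big: "s * s < card (carrier G)"
  shows "card (carrier G) * (p - 1)
    \<le> s * card (p_torsion p) + card (carrier G) * card (p_torsion p \<inter> centre)"
proof -
  let ?h = "card (carrier G)"
  obtain P where P: "subgroup P G" "card P = p" using exists_prime_subgroup[OF fin p] .
  have PG: "P \<subseteq> carrier G" by (rule subgroup.subset[OF P(1)])
  have fP: "finite P" using fin PG finite_subset by blast
  let ?N = "{g \<in> carrier G. conj_by g ` P = P}"
  show ?thesis
  proof (cases "?N = carrier G")
    case False
    then have "card ?N \<le> s" using proper[OF subgroup_conj_stabiliser[OF PG]] by blast
    then have "?h * (p - 1) \<le> s * card (p_torsion p)"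
      using card_fibre_conj_torsion[OF fin P(1)] P(2) p(1) by (meson le_trans mult_le_mono1)
    then show ?thesis by simp
  next
    case True
    have "P \<noteq> carrier G" using np P(2) p(1) by metis
    then have Ps: "card P \<le> s" using proper[OF P(1)] by blast
    have "P \<subseteq> centre"
    proof
      fix x assume x: "x \<in> P"
      then have xG: "x \<in> carrier G" using PG by blast
      let ?C = "{g \<in> carrier G. conj_by g x = x}"
      have "(\<lambda>g. conj_by g x) ` carrier G \<subseteq> P" using True x by blast
      then have "?h \<le> card ?C * card P"
        using card_le_centraliser_mult_class[OF fin xG _ fP] by blast
      then have "\<not> card ?C \<le> s" using big Ps by (meson le_trans mult_le_mono not_le)
      then have "?C = carrier G" using proper[OF subgroup_centraliser[OF xG]] by blast
      then show "x \<in> centre" using xG by (auto simp: centre_def)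
    qed
    then have "P - {\<one>} \<subseteq> p_torsion p \<inter> centre"
      using prime_subgroup_torsion[OF P(1) fin] P(2) by blast
    moreover have "finite (p_torsion p \<inter> centre)" using fin by (simp add: p_torsion_def)
    ultimately have "card (P - {\<one>}) \<le> card (p_torsion p \<inter> centre)" by (rule card_mono[rotated])
    moreover have "card (P - {\<one>}) = p - 1" using P fP subgroup.one_closed[OF P(1)] by simp
    ultimately show ?thesis by (simp add: add_increasing)
  qed
qed

text \<open>Apart from orders \<open>1\<close> and at most \<open>s * s\<close>, \<open>w\<close> is
  the number of prime divisors, each contributing a factor of at most \<open>s\<close> by
  \<open>sylow_part_bound\<close>. The second conjunct states \<open>w = O(sqrt s)\<close> without
  roots.\<close>

lemma card_le_power_of_proper_subgroups:
  assumes fin: "finite (carrier G)" and np: "\<not> prime (card (carrier G))"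
    and proper: "\<And>K. subgroup K G \<Longrightarrow> K \<noteq> carrier G \<Longrightarrow> card K \<le> s"
  shows "\<exists>w. card (carrier G) \<le> s ^ w \<and> w * (w + 1) \<le> 4 * s"
proof (cases "card (carrier G) = 1 \<or> card (carrier G) \<le> s * s")
  case True
  show ?thesis
  proof (cases "card (carrier G) = 1")
    case True
    then show ?thesis by (intro exI[of _ 0]) simp
  next
    case False
    obtain p where p: "prime p" "p dvd card (carrier G)" using prime_factor_nat[OF False] by blast
    obtain P where P: "subgroup P G" "card P = p" using exists_prime_subgroup[OF fin p] .
    \<comment> \<open>\<open>P\<close> is proper because the order of the group is not prime. The
      resulting \<open>2 \<le> s\<close> gives \<open>2 * 3 \<le> 4 * s\<close> for the witness
      \<open>w = 2\<close>.\<close>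
    then have "p \<le> s" using proper[OF P(1)] np p(1) by metis
    then have "2 \<le> s" using prime_ge_2_nat[OF p(1)] by simp
    then show ?thesis using True False by (intro exI[of _ 2]) (simp add: power2_eq_square)
  qed
next
  case False
  let ?h = "card (carrier G)"
  let ?PF = "prime_factors ?h"
  have h0: "?h \<noteq> 0" using fin by auto
  have pf: "prime p \<and> p dvd ?h" if "p \<in> ?PF" for p using that by auto
  have cs: "card centre \<le> s"
  proof (rule proper[OF subgroup_centre], rule)
    assume c: "centre = carrier G"
    obtain p where p: "prime p" "p dvd ?h" using prime_factor_nat False by blast
    have "x \<otimes> y = y \<otimes> x" if "x \<in> carrier G" "y \<in> carrier G" for x y
      using that c conj_by_eq_iff by (auto simp: centre_def)
    then show False using card_le_square_if_comm[OF fin p np proper] False by blast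
  qed
  have disj: "(\<Sum>p\<in>?PF. card (p_torsion p \<inter> B)) \<le> card B" if "B \<subseteq> carrier G" for B
  proof -
    have fB: "finite B" using that fin finite_subset by blast
    have "(\<Sum>p\<in>?PF. card (p_torsion p \<inter> B)) = card (\<Union>p\<in>?PF. p_torsion p \<inter> B)"
      using fB pf p_torsion_disjoint by (subst card_UN_disjoint) blast+
    also have "\<dots> \<le> card B" using fB by (intro card_mono) auto
    finally show ?thesis .
  qed
  \<comment> \<open>By disjointness the torsion sets have at most \<open>?h\<close> elements in
    total, and at most \<open>card centre \<le> s\<close> of these are central. Both parts of the
    summed bound are therefore at most \<open>s * ?h\<close>.\<close>
  have "?h * (\<Sum>p\<in>?PF. p - 1) = (\<Sum>p\<in>?PF. ?h * (p - 1))" by (simp add: sum_distrib_left)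
  also have "\<dots> \<le> (\<Sum>p\<in>?PF. s * card (p_torsion p \<inter> carrier G) + ?h * card (p_torsion p \<inter> centre))"
  proof (rule sum_mono)
    fix p assume "p \<in> ?PF"
    moreover have "p_torsion p \<inter> carrier G = p_torsion p" by (auto simp: p_torsion_def)
    ultimately show "?h * (p - 1) \<le> s * card (p_torsion p \<inter> carrier G) + ?h * card (p_torsion p \<inter> centre)"
      using prime_torsion_bound[OF fin _ _ np proper] False pf by (metis not_le)
  qed
  also have "\<dots> = s * (\<Sum>p\<in>?PF. card (p_torsion p \<inter> carrier G)) + ?h * (\<Sum>p\<in>?PF. card (p_torsion p \<inter> centre))"
    by (simp add: sum.distrib sum_distrib_left)
  also have "\<dots> \<le> s * ?h + ?h * s"
    using disj[of "carrier G"] disj[of centre] cs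
    by (intro add_mono mult_le_mono2) (auto simp: centre_def)
  also have "\<dots> = ?h * (2 * s)" by simp
  finally have sum: "(\<Sum>p\<in>?PF. p - 1) \<le> 2 * s" using h0 by simp
  \<comment> \<open>The shifted primes are distinct and positive, as
    \<open>sum_ge_triangular\<close> requires.\<close>
  let ?A = "(\<lambda>p. p - 1) ` ?PF"
  have p1: "1 < p" if "p \<in> ?PF" for p using pf[OF that] prime_gt_1_nat by blast
  have inj: "inj_on (\<lambda>p. p - 1) ?PF"
  proof (rule inj_onI)
    fix p q assume "p \<in> ?PF" "q \<in> ?PF" and e: "p - 1 = q - 1"
    then have "1 < p" "1 < q" using p1 by blast+
    then show "p = q" using e by linarith
  qed
  have "0 \<notin> ?A"
  proof
    assume "0 \<in> ?A"
    then obtain p where "p \<in> ?PF" "p - 1 = 0" by (metis imageE)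
    then show False using p1[of p] by linarith
  qed
  then have "card ?A * (card ?A + 1) \<le> 2 * \<Sum>?A" by (intro sum_ge_triangular) auto
  moreover have "\<Sum>?A = (\<Sum>p\<in>?PF. p - 1)" using inj by (simp add: sum.reindex)
  moreover have "card ?A = card ?PF" using inj by (rule card_image)
  ultimately have w: "card ?PF * (card ?PF + 1) \<le> 4 * s" using sum by simp
  have "?h = (\<Prod>p\<in>?PF. p ^ multiplicity p ?h)"
    using h0 by (intro prime_factorization_nat) auto
  also have "\<dots> \<le> (\<Prod>p\<in>?PF. s)"
    using sylow_part_bound[OF fin _ _ np proper] False pf by (intro prod_mono) auto
  finally show ?thesis using w by auto
qed

section \<open>Coding normal subgroups of finite index\<close>

text \<open>\<open>\<eta>\<close> is the discrete logarithm to the base of a nontrivial element,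
  which generates \<open>H\<close>.\<close>

lemma prime_subgroup_code:
  assumes fin: "finite (carrier G)" and H: "subgroup H G" "prime (card H)"
  obtains \<eta> :: "'a \<Rightarrow> nat" where "inj_on \<eta> H" "\<eta> ` H \<subseteq> {..<card H}"
    "\<And>a b. a \<in> H \<Longrightarrow> b \<in> H \<Longrightarrow> \<eta> (a \<otimes> b) = (\<eta> a + \<eta> b) mod card H"
proof -
  let ?p = "card H"
  have fH: "finite H" using H(2) by (metis card.infinite not_prime_0)
  have "1 < card H" using H(2) prime_gt_1_nat by blast
  then have "H \<noteq> {\<one>}" by auto
  then obtain x where x: "x \<in> H" "x \<noteq> \<one>" using subgroup.one_closed[OF H(1)] by blast
  have xG: "x \<in> carrier G" using x subgroup.subset[OF H(1)] by blast
  have xp: "x [^] ?p = \<one>" using pow_card_subgroup[OF H(1) fin x(1)] .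
  then have "ord x dvd ?p" using pow_eq_id[OF xG] by blast
  moreover have "ord x \<noteq> 1" using ord_eq_1[OF xG] x(2) by simp
  ultimately have o: "ord x = ?p" using H(2) by (auto simp: prime_nat_iff)
  let ?e = "\<lambda>j::nat. x [^] j"
  have "{0..ord x - 1} = {..<?p}" using o prime_gt_0_nat[OF H(2)] by auto
  then have inj: "inj_on ?e {..<?p}" using ord_inj[OF xG] by simp
  have "x [^] j \<in> H" for j :: nat
    by (induction j) (use x(1) H(1) subgroup.one_closed subgroup.m_closed in auto)
  then have "?e ` {..<?p} \<subseteq> H" by blast
  then have img: "?e ` {..<?p} = H"
    using fH card_image[OF inj] by (intro card_subset_eq) auto
  define \<eta> where "\<eta> = inv_into {..<?p} ?e"
  have \<eta>: "\<eta> a < ?p" "x [^] \<eta> a = a" if "a \<in> H" for a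
    using that img inv_into_into[of a ?e "{..<?p}"] f_inv_into_f[of a ?e "{..<?p}"] by (auto simp: \<eta>_def)
  show ?thesis
  proof (rule that[of \<eta>])
    show "inj_on \<eta> H" using \<eta>(2) by (metis inj_onI)
    show "\<eta> ` H \<subseteq> {..<?p}" using \<eta>(1) by auto
    fix a b assume ab: "a \<in> H" "b \<in> H"
    let ?n = "\<eta> a + \<eta> b"
    have "a \<otimes> b = x [^] ?n" using \<eta>(2) ab xG by (metis nat_pow_mult)
    also have "\<dots> = x [^] (?p * (?n div ?p) + ?n mod ?p)" by simp
    also have "\<dots> = x [^] (?p * (?n div ?p)) \<otimes> x [^] (?n mod ?p)" using xG by (metis nat_pow_mult)
    also have "x [^] (?p * (?n div ?p)) = \<one>" using xG xp by (metis nat_pow_pow nat_pow_one)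
    finally have "a \<otimes> b = x [^] (?n mod ?p)" using xG by simp
    then show "\<eta> (a \<otimes> b) = ?n mod ?p"
      unfolding \<eta>_def using prime_gt_0_nat[OF H(2)] by (simp add: inv_into_f_f[OF inj])
  qed
qed

text \<open>This is the embedding into a wreath product. Write \<open>q = part q \<otimes> r\<close>
  with \<open>r\<close> the representative of \<open>H #> q\<close>, and let \<open>r'\<close>
  represent \<open>H #> (r \<otimes> x)\<close>. Then \<open>q \<otimes> x = part q \<otimes> (r
  \<otimes> x \<otimes> inv r') \<otimes> r'\<close>, where the bracket lies in \<open>H\<close> and
  depends only on \<open>x\<close> and the coset of \<open>q\<close>. \<open>\<sigma>\<close>
  records the new coset and \<open>c\<close> the bracket.\<close>

lemma exists_coset_code:
  fixes \<mu> :: "nat \<times> nat \<Rightarrow> nat"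
  assumes fin: "finite (carrier G)" and H: "subgroup H G" and t: "card (rcosets H) \<le> t"
    and \<eta>: "inj_on \<eta> H" "\<eta> ` H \<subseteq> {..<h}"
    and hom: "\<And>a b. a \<in> H \<Longrightarrow> b \<in> H \<Longrightarrow> \<eta> (a \<otimes> b) = \<mu> (\<eta> a, \<eta> b)"
  obtains \<beta> :: "'a \<Rightarrow> nat \<times> nat" and \<sigma> c :: "'a \<Rightarrow> nat \<Rightarrow> nat" where
    "inj_on \<beta> (carrier G)" "\<beta> ` carrier G \<subseteq> {..<t} \<times> {..<h}"
    "\<And>x i. x \<in> carrier G \<Longrightarrow> i < t \<Longrightarrow> \<sigma> x i < t \<and> c x i < h"
    "\<And>q x. q \<in> carrier G \<Longrightarrow> x \<in> carrier G \<Longrightarrow>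
       \<beta> (q \<otimes> x) = (\<sigma> x (fst (\<beta> q)), \<mu> (snd (\<beta> q), c x (fst (\<beta> q))))"
proof -
  let ?R = "rcosets H"
  have HG: "H \<subseteq> carrier G" using subgroup.subset[OF H] .
  have fR: "finite ?R" using fin by (auto simp: RCOSETS_def)
  obtain enc where enc: "inj_on enc ?R" "enc ` ?R \<subseteq> {..<t}"
    using card_le_inj[of ?R "{..<t}"] fR t by auto
  define rep where "rep C = (SOME r. r \<in> C)" for C :: "'a set"
  have rep: "rep (H #> q) \<in> H #> q" if "q \<in> carrier G" for q
    unfolding rep_def using rcos_self[OF that H] by (rule someI)
  have repG: "rep (H #> q) \<in> carrier G" if "q \<in> carrier G" for q
    using rep[OF that] r_coset_subset_G[OF HG that] by blast
  have repc: "H #> rep (H #> q) = H #> q" if "q \<in> carrier G" for q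
    using repr_independence[OF rep[OF that] that H] by simp
  have rel: "p \<otimes> inv q \<in> H" if "p \<in> carrier G" "q \<in> carrier G" "H #> p = H #> q" for p q
    using rcos_self[OF that(1) H] subgroup.rcos_module_imp[OF H is_group that(2)] that(3) by simp
  have coset_mult: "H #> (rep (H #> q) \<otimes> x) = H #> (q \<otimes> x)" if "q \<in> carrier G" "x \<in> carrier G" for q x
    using that repc repG HG by (metis coset_mult_assoc)
  define part where "part q = q \<otimes> inv rep (H #> q)" for q
  have part: "part q \<in> H" if "q \<in> carrier G" for q
    unfolding part_def using rel[OF that repG[OF that]] repc[OF that] by simp
  define \<beta> where "\<beta> q = (enc (H #> q), \<eta> (part q))" for q
  define dec where "dec i = rep (inv_into ?R enc i)" for i
  have mem: "H #> q \<in> ?R" if "q \<in> carrier G" for q using that by (auto simp: RCOSETS_def)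
  have dec: "dec (enc (H #> q)) = rep (H #> q)" if "q \<in> carrier G" for q
    unfolding dec_def using inv_into_f_f[OF enc(1) mem[OF that]] by simp
  have encR: "\<exists>q\<in>carrier G. i = enc (H #> q)" if "i \<in> enc ` ?R" for i
    using that by (auto simp: RCOSETS_def)
  define cc where "cc x i = dec i \<otimes> x \<otimes> inv rep (H #> (dec i \<otimes> x))" for x i
  \<comment> \<open>As \<open>t\<close> only bounds the index, some \<open>i < t\<close> may encode
    no coset; the default \<open>0\<close> keeps the values in range.\<close>
  define \<sigma> where "\<sigma> x i = (if i \<in> enc ` ?R then enc (H #> (dec i \<otimes> x)) else 0)" for x i
  define c where "c x i = (if i \<in> enc ` ?R then \<eta> (cc x i) else 0)" for x i
  have cc: "cc x (enc (H #> q)) \<in> H" if "q \<in> carrier G" "x \<in> carrier G" for q x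
    unfolding cc_def dec[OF that(1)] using that repG
    by (intro rel) (auto simp: repc)
  have h0: "0 < h" using \<eta>(2) subgroup.one_closed[OF H] by fastforce
  show ?thesis
  proof (rule that[of \<beta> \<sigma> c])
    show "\<beta> ` carrier G \<subseteq> {..<t} \<times> {..<h}"
    proof
      fix z assume "z \<in> \<beta> ` carrier G"
      then obtain q where q: "q \<in> carrier G" "z = \<beta> q" by blast
      have "enc (H #> q) \<in> {..<t}" "\<eta> (part q) \<in> {..<h}"
        using enc(2) mem[OF q(1)] part[OF q(1)] \<eta>(2) by blast+
      then show "z \<in> {..<t} \<times> {..<h}" by (simp add: q(2) \<beta>_def)
    qed
    show "inj_on \<beta> (carrier G)"
    proof (rule inj_onI)
      fix p q assume pq: "p \<in> carrier G" "q \<in> carrier G" and e: "\<beta> p = \<beta> q"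
      have 1: "H #> p = H #> q" using e enc(1) mem pq by (auto simp: \<beta>_def dest: inj_onD)
      have "part p = part q" using e \<eta>(1) part pq by (auto simp: \<beta>_def dest: inj_onD)
      then have "p \<otimes> inv rep (H #> q) = q \<otimes> inv rep (H #> q)" using 1 by (simp add: part_def)
      then show "p = q" using pq repG by simp
    qed
  next
    fix x i assume x: "x \<in> carrier G" and i: "i < t"
    show "\<sigma> x i < t \<and> c x i < h"
    proof (cases "i \<in> enc ` ?R")
      case True
      then obtain q where q: "q \<in> carrier G" "i = enc (H #> q)" using encR by blast
      have "\<sigma> x i \<in> enc ` ?R"
        using True q repG[OF q(1)] x by (auto simp: \<sigma>_def dec intro!: imageI mem)
      moreover have "c x i \<in> \<eta> ` H" using True q cc[OF q(1) x] by (auto simp: c_def)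
      ultimately show ?thesis using enc(2) \<eta>(2) by blast
    next
      case False
      then show ?thesis using i h0 by (simp add: \<sigma>_def c_def)
    qed
  next
    fix q x assume q: "q \<in> carrier G" and x: "x \<in> carrier G"
    let ?r = "rep (H #> q)" and ?r' = "rep (H #> (q \<otimes> x))"
    have r: "?r \<in> carrier G" "?r' \<in> carrier G" using repG q x by auto
    have i: "enc (H #> q) \<in> enc ` ?R" using mem[OF q] by blast
    have cq: "cc x (enc (H #> q)) = ?r \<otimes> x \<otimes> inv ?r'"
      by (simp add: cc_def dec[OF q] coset_mult[OF q x])
    have "part (q \<otimes> x) = part q \<otimes> cc x (enc (H #> q))"
      unfolding part_def cq using q x r by (simp add: m_assoc inv_solve_left)
    then have "\<eta> (part (q \<otimes> x)) = \<mu> (\<eta> (part q), \<eta> (cc x (enc (H #> q))))"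
      using hom[OF part[OF q] cc[OF q x]] by simp
    then show "\<beta> (q \<otimes> x) = (\<sigma> x (fst (\<beta> q)), \<mu> (snd (\<beta> q), c x (fst (\<beta> q))))"
      using i by (simp add: \<beta>_def \<sigma>_def c_def dec[OF q] coset_mult[OF q x])
  qed
qed

end

text \<open>Addition modulo \<open>p\<close> serves for the groups of prime order, which may be larger than \<open>u\<close>.\<close>

definition small_operations :: "nat \<Rightarrow> nat \<Rightarrow> (nat \<times> nat \<Rightarrow> nat) set" where
  "small_operations u m =
     ({..<u} \<times> {..<u} \<rightarrow>\<^sub>E {..<u}) \<union> (\<lambda>p (a, b). (a + b) mod p) ` {..m}"

text \<open>In order: the label of the identity coset, the maps on \<open>H\<close>-cosets, the
  \<open>H\<close>-components, and the multiplication of \<open>H\<close>. Extensional function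
  spaces keep the set finite.\<close>

definition group_codes where
  "group_codes X t m u =
     ({..<t} \<times> {..<m}) \<times> (X \<rightarrow>\<^sub>E {..<t} \<rightarrow>\<^sub>E {..<t}) \<times> (X \<rightarrow>\<^sub>E {..<t} \<rightarrow>\<^sub>E {..<m}) \<times> small_operations u m"

section \<open>Existence and uniqueness of codes\<close>

context group
begin

text \<open>If the order is below \<open>s\<close>, the trivial subgroup has index at most
  \<open>s \<le> m div s\<close>. Otherwise a smallest subgroup of order at least \<open>s\<close>
  has only proper subgroups of order at most \<open>s\<close>, and \<open>u\<close> absorbs the
  bound \<open>s ^ w\<close> on its order.\<close>

lemma exists_codable_subgroup:
  assumes fin: "finite (carrier G)" and m: "card (carrier G) \<le> m"
    and s: "1 \<le> s" "s * s \<le> m" and u: "\<And>w. w * (w + 1) \<le> 4 * s \<Longrightarrow> s ^ w \<le> u"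
  obtains H where "subgroup H G" "card (rcosets H) \<le> m div s" "card H \<le> u \<or> prime (card H)"
proof (cases "card (carrier G) < s")
  case True
  have "s \<le> m div s" using s by (simp add: less_eq_div_iff_mult_less_eq)
  moreover have "card (rcosets {\<one>}) = card (carrier G)"
    using card_rcosets_triv fin by (simp add: order_def)
  moreover have "1 \<le> u" using u[of 0] by simp
  ultimately show ?thesis using True triv_subgroup that[of "{\<one>}"] by simp
next
  case False
  let ?P = "\<lambda>H. subgroup H G \<and> s \<le> card H"
  have "?P (carrier G)" using False subgroup_self by simp
  then obtain H where H: "?P H" and min: "\<And>K. ?P K \<Longrightarrow> card H \<le> card K"
    using ex_has_least_nat[of ?P "carrier G" card] by blast
  have fH: "finite H" using H fin by (meson finite_subset subgroup.subset)
  interpret H: group "G\<lparr>carrier := H\<rparr>" using H subgroup_imp_group by blast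
  have proper: "card K \<le> s" if K: "subgroup K (G\<lparr>carrier := H\<rparr>)" "K \<noteq> H" for K
  proof (rule ccontr)
    assume "\<not> card K \<le> s"
    then have "?P K" using H incl_subgroup K(1) by auto
    then have "card H \<le> card K" using min by blast
    moreover have "K \<subseteq> H" using subgroup.subset[OF K(1)] by simp
    ultimately show False using K(2) fH by (metis card_seteq)
  qed
  have "card H \<le> u \<or> prime (card H)"
  proof (rule disjCI)
    assume "\<not> prime (card H)"
    then obtain w where "card H \<le> s ^ w" "w * (w + 1) \<le> 4 * s"
      using H.card_le_power_of_proper_subgroups[of s] proper fH by auto
    then show "card H \<le> u" using u le_trans by blast
  qed
  moreover have "card (rcosets H) \<le> m div s"
  proof -
    have "card (rcosets H) * s \<le> card (rcosets H) * card H" using H by simp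
    also have "\<dots> \<le> m" using lagrange[of H] H m by (simp add: order_def)
    finally show ?thesis using s by (simp add: less_eq_div_iff_mult_less_eq)
  qed
  ultimately show ?thesis using H that by blast
qed

lemma exists_subgroup_code:
  assumes fin: "finite (carrier G)" and H: "subgroup H G" and m: "card H \<le> m"
    and u: "card H \<le> u \<or> prime (card H)"
  obtains \<eta> :: "'a \<Rightarrow> nat" and \<mu> where "inj_on \<eta> H" "\<eta> ` H \<subseteq> {..<m}"
    "\<And>a b. a \<in> H \<Longrightarrow> b \<in> H \<Longrightarrow> \<eta> (a \<otimes> b) = \<mu> (\<eta> a, \<eta> b)" "\<mu> \<in> small_operations u m"
proof (cases "prime (card H)")
  case True
  obtain \<eta> :: "'a \<Rightarrow> nat" where \<eta>: "inj_on \<eta> H" "\<eta> ` H \<subseteq> {..<card H}"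
    "\<And>a b. a \<in> H \<Longrightarrow> b \<in> H \<Longrightarrow> \<eta> (a \<otimes> b) = (\<eta> a + \<eta> b) mod card H"
    using prime_subgroup_code[OF fin H True] by blast
  show ?thesis
  proof (rule that[of \<eta> "\<lambda>(a, b). (a + b) mod card H"])
    show "\<eta> ` H \<subseteq> {..<m}" using \<eta>(2) m by auto
    show "(\<lambda>(a, b). (a + b) mod card H) \<in> small_operations u m"
      unfolding small_operations_def using m by blast
  qed (use \<eta> in auto)
next
  case False
  have fH: "finite H" using H fin by (meson finite_subset subgroup.subset)
  obtain \<eta> where \<eta>: "bij_betw \<eta> H {0..<card H}" using ex_bij_betw_finite_nat[OF fH] by blast
  then have inj: "inj_on \<eta> H" and img: "\<eta> ` H = {..<card H}"
    by (auto simp: bij_betw_def lessThan_atLeast0)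
  define d where "d = inv_into H \<eta>"
  have d: "d (\<eta> a) = a" if "a \<in> H" for a using that inj by (simp add: d_def)
  \<comment> \<open>The multiplication is transported along an arbitrary numbering of
    \<open>H\<close> and padded with \<open>0\<close> to a table of size \<open>u\<close>, so that
    the set of candidates does not depend on \<open>card H\<close>.\<close>
  define \<mu> where "\<mu> = restrict (\<lambda>(i, j). if i < card H \<and> j < card H then \<eta> (d i \<otimes> d j) else 0)
    ({..<u} \<times> {..<u})"
  have less: "\<eta> a < card H" if "a \<in> H" for a using that img by blast
  have cu: "card H \<le> u" using u False by blast
  have pos: "0 < card H" using subgroup.finite_imp_card_positive[OF H fin] .
  show ?thesis
  proof (rule that[of \<eta> \<mu>])
    show "\<eta> ` H \<subseteq> {..<m}" using img m by auto
    fix a b assume ab: "a \<in> H" "b \<in> H"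
    have "\<eta> a < u" "\<eta> b < u" using less ab cu by (meson less_le_trans)+
    then show "\<eta> (a \<otimes> b) = \<mu> (\<eta> a, \<eta> b)" using ab less by (simp add: \<mu>_def d)
  next
    have "\<mu> \<in> {..<u} \<times> {..<u} \<rightarrow>\<^sub>E {..<u}"
    proof (rule PiE_I)
      fix z assume z: "z \<in> {..<u} \<times> {..<u}"
      obtain i j where ij: "z = (i, j)" by fastforce
      have "\<eta> (d i \<otimes> d j) < u" if "i < card H" "j < card H"
      proof -
        have "d i \<in> H" "d j \<in> H" using that img inv_into_into[of _ \<eta> H] unfolding d_def by auto
        then have "d i \<otimes> d j \<in> H" using subgroup.m_closed[OF H] by blast
        then show ?thesis using less cu by (meson less_le_trans)
      qed
      then show "\<mu> z \<in> {..<u}" using z ij pos cu by (auto simp: \<mu>_def)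
    qed (simp add: \<mu>_def)
    then show "\<mu> \<in> small_operations u m" by (simp add: small_operations_def)
  qed (rule inj)
qed

text \<open>The function \<open>f\<close> labels a coset of \<open>N\<close> by a pair: the index of its \<open>H\<close>-coset in the quotient
  and the \<open>H\<close>-component. As \<open>X\<close> is closed under inverses, the code determines \<open>f\<close>.\<close>

fun coded_by where
  "coded_by X N (b, \<sigma>, c, \<mu>) f \<longleftrightarrow>
     f \<one> = b \<and> (\<forall>g\<in>carrier G. f g = b \<longleftrightarrow> g \<in> N) \<and>
     (\<forall>x\<in>X. \<forall>g\<in>carrier G. f (g \<otimes> x) = (\<sigma> x (fst (f g)), \<mu> (snd (f g), c x (fst (f g)))))"

lemma coded_by_unique:
  assumes X: "X \<subseteq> carrier G" "m_inv G ` X \<subseteq> X" "generate G X = carrier G"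
    and f: "coded_by X N d f" "coded_by X N' d f'" and N: "N \<subseteq> carrier G" "N' \<subseteq> carrier G"
  shows "N = N'"
proof -
  obtain b \<sigma> c \<mu> where d: "d = (b, \<sigma>, c, \<mu>)" by (metis surj_pair)
  have step: "f (a \<otimes> x) = f' (a \<otimes> x)" if "x \<in> X" "a \<in> carrier G" "f a = f' a" for a x
    using f that by (simp add: d)
  \<comment> \<open>Quantifying over \<open>a\<close> lets the induction treat a product by applying
    the two hypotheses in succession.\<close>
  have "\<forall>a\<in>carrier G. f a = f' a \<longrightarrow> f (a \<otimes> g) = f' (a \<otimes> g)" if "g \<in> generate G X" for g
    using that
  proof (induction g rule: generate.induct)
    case one
    then show ?case by simp
  next
    case (incl h)
    then show ?case using step by blast
  next
    case (inv h)
    then show ?case using step X(2) by blast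
  next
    case (eng h1 h2)
    have "h1 \<in> carrier G" "h2 \<in> carrier G" using eng.hyps X(3) by auto
    then show ?case using eng.IH by (simp add: m_assoc[symmetric])
  qed
  moreover have "f \<one> = f' \<one>" using f by (simp add: d)
  ultimately have "f (\<one> \<otimes> g) = f' (\<one> \<otimes> g)" if "g \<in> carrier G" for g
    using that X(3) one_closed by blast
  then have "f g = f' g" if "g \<in> carrier G" for g
    using that by (metis l_one)
  then show ?thesis using f N by (auto simp: d)
qed

text \<open>The labelling of the quotient by \<open>\<beta>\<close> is pulled back to
  \<open>G\<close>; since \<open>\<beta>\<close> is injective, \<open>N\<close> is the fibre over
  the label of the identity.\<close>

lemma exists_code:
  assumes X: "X \<subseteq> carrier G" and N: "N \<lhd> G" "finite (rcosets N)" "card (rcosets N) \<le> m"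
    and s: "1 \<le> s" "s * s \<le> m" and u: "\<And>w. w * (w + 1) \<le> 4 * s \<Longrightarrow> s ^ w \<le> u"
  shows "\<exists>d\<in>group_codes X (m div s) m u. \<exists>f. coded_by X N d f"
proof -
  let ?Q = "G Mod N" and ?t = "m div s"
  interpret N: normal N G by (rule N(1))
  interpret Q: group ?Q by (rule N.factorgroup_is_group)
  have cQ: "carrier ?Q = rcosets N" by (simp add: FactGroup_def)
  have fin: "finite (carrier ?Q)" "card (carrier ?Q) \<le> m" using N cQ by auto
  obtain H where H: "subgroup H ?Q" "card (rcosets\<^bsub>?Q\<^esub> H) \<le> ?t" "card H \<le> u \<or> prime (card H)"
    using Q.exists_codable_subgroup[OF fin s u] by blast
  have "card H \<le> m" using card_mono[OF fin(1) subgroup.subset[OF H(1)]] fin(2) by simp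
  from Q.exists_subgroup_code[OF fin(1) H(1) this H(3)]
  obtain \<eta> :: "'a set \<Rightarrow> nat" and \<mu> where \<eta>: "inj_on \<eta> H" "\<eta> ` H \<subseteq> {..<m}"
    "\<And>a b. a \<in> H \<Longrightarrow> b \<in> H \<Longrightarrow> \<eta> (a \<otimes>\<^bsub>?Q\<^esub> b) = \<mu> (\<eta> a, \<eta> b)" and \<mu>: "\<mu> \<in> small_operations u m"
    by metis
  from Q.exists_coset_code[OF fin(1) H(1,2) \<eta>]
  obtain \<beta> :: "'a set \<Rightarrow> nat \<times> nat" and \<sigma> c :: "'a set \<Rightarrow> nat \<Rightarrow> nat" where
    \<beta>: "inj_on \<beta> (carrier ?Q)" "\<beta> ` carrier ?Q \<subseteq> {..<?t} \<times> {..<m}"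
    and \<sigma>: "\<And>x i. x \<in> carrier ?Q \<Longrightarrow> i < ?t \<Longrightarrow> \<sigma> x i < ?t \<and> c x i < m"
    and mult: "\<And>q x. q \<in> carrier ?Q \<Longrightarrow> x \<in> carrier ?Q \<Longrightarrow>
       \<beta> (q \<otimes>\<^bsub>?Q\<^esub> x) = (\<sigma> x (fst (\<beta> q)), \<mu> (snd (\<beta> q), c x (fst (\<beta> q))))"
    by metis
  define f where "f g = \<beta> (N #> g)" for g
  define \<sigma>' where "\<sigma>' = (\<lambda>x\<in>X. \<lambda>i\<in>{..<?t}. \<sigma> (N #> x) i)"
  define c' where "c' = (\<lambda>x\<in>X. \<lambda>i\<in>{..<?t}. c (N #> x) i)"
  have mem: "N #> g \<in> carrier ?Q" if "g \<in> carrier G" for g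
    using that by (auto simp: cQ RCOSETS_def)
  have ft: "fst (f g) < ?t" if "g \<in> carrier G" for g
    using \<beta>(2) mem[OF that] by (force simp: f_def)
  have 1: "(f \<one>, \<sigma>', c', \<mu>) \<in> group_codes X ?t m u"
    unfolding group_codes_def
  proof (intro SigmaI)
    show "f \<one> \<in> {..<?t} \<times> {..<m}" using \<beta>(2) mem by (auto simp: f_def)
    show "\<sigma>' \<in> X \<rightarrow>\<^sub>E {..<?t} \<rightarrow>\<^sub>E {..<?t}" "c' \<in> X \<rightarrow>\<^sub>E {..<?t} \<rightarrow>\<^sub>E {..<m}"
      using \<sigma> mem X unfolding \<sigma>'_def c'_def by (auto intro!: restrict_PiE_iff[THEN iffD2])
  qed (rule \<mu>)
  have "f g = f \<one> \<longleftrightarrow> g \<in> N" if "g \<in> carrier G" for g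
  proof -
    have "f g = f \<one> \<longleftrightarrow> N #> g = N #> \<one>"
      unfolding f_def by (rule inj_on_eq_iff[OF \<beta>(1) mem[OF that] mem[OF one_closed]])
    also have "\<dots> \<longleftrightarrow> N #> g = N" using coset_mult_one[OF N.subset] by simp
    also have "\<dots> \<longleftrightarrow> g \<in> N"
      using that N.rcos_const rcos_self[OF that N.subgroup_axioms] is_group by metis
    finally show ?thesis .
  qed
  moreover have "f (g \<otimes> x) = (\<sigma>' x (fst (f g)), \<mu> (snd (f g), c' x (fst (f g))))"
    if "x \<in> X" "g \<in> carrier G" for x g
  proof -
    have x: "x \<in> carrier G" using X that by blast
    have "f (g \<otimes> x) = \<beta> ((N #> g) \<otimes>\<^bsub>?Q\<^esub> (N #> x))"
      using N.rcos_sum that x by (simp add: f_def)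
    also have "\<dots> = (\<sigma>' x (fst (f g)), \<mu> (snd (f g), c' x (fst (f g))))"
      using mult[OF mem[OF that(2)] mem[OF x]] that ft[OF that(2)] by (simp add: f_def \<sigma>'_def c'_def)
    finally show ?thesis .
  qed
  ultimately have "coded_by X N (f \<one>, \<sigma>', c', \<mu>) f" by simp
  then show ?thesis using 1 by blast
qed

end

section \<open>Counting codes and normal subgroups of small index\<close>

lemma card_small_operations:
  "finite (small_operations u m) \<and> card (small_operations u m) \<le> u ^ (u * u) + (m + 1)"
proof -
  let ?A = "{..<u} \<times> {..<u} \<rightarrow>\<^sub>E {..<u}"
  let ?B = "(\<lambda>p (a, b). (a + b) mod p) ` {..m}"
  have "card ?B \<le> m + 1" using card_image_le[of "{..m}"] by simp
  moreover have "card ?A = u ^ (u * u)" by (simp add: card_PiE)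
  moreover have "finite ?A" "finite ?B" by (auto intro: finite_PiE)
  ultimately show ?thesis
    unfolding small_operations_def using card_Un_le[of ?A ?B] by simp
qed

text \<open>The two families of maps contribute \<open>m ^ (t * card X)\<close> each. With
  \<open>t = m div s\<close> and \<open>s\<close> a large multiple of \<open>ln m\<close>, this is
  the exponential of a small multiple of \<open>m\<close>.\<close>

lemma card_group_codes:
  assumes "finite X" "t \<le> m"
  shows "finite (group_codes X t m u) \<and>
    card (group_codes X t m u) \<le> m ^ 2 * m ^ (2 * t * card X) * (u ^ (u * u) + (m + 1))"
proof -
  note small = card_small_operations[of u m]
  have fin: "finite (X \<rightarrow>\<^sub>E {..<t} \<rightarrow>\<^sub>E {..<k})" for k :: nat
    by (intro finite_PiE assms(1)) (rule finite_lessThan)+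
  have crd: "card (X \<rightarrow>\<^sub>E {..<t} \<rightarrow>\<^sub>E {..<k}) \<le> m ^ (t * card X)" if "k \<le> m" for k :: nat
  proof -
    have "card (X \<rightarrow>\<^sub>E {..<t} \<rightarrow>\<^sub>E {..<k}) = (k ^ t) ^ card X"
      using assms(1) by (simp add: card_PiE)
    also have "\<dots> \<le> (m ^ t) ^ card X" using that by (intro power_mono) auto
    finally show ?thesis by (simp only: power_mult)
  qed
  have double: "m ^ (2 * t * card X) = m ^ (t * card X) * m ^ (t * card X)"
    by (simp only: mult_2 add_mult_distrib power_add)
  have "card (group_codes X t m u) = (t * m) * (card (X \<rightarrow>\<^sub>E {..<t} \<rightarrow>\<^sub>E {..<t}) *
      (card (X \<rightarrow>\<^sub>E {..<t} \<rightarrow>\<^sub>E {..<m}) * card (small_operations u m)))"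
    by (simp add: group_codes_def card_cartesian_product)
  also have "\<dots> \<le> (m * m) * (m ^ (t * card X) * (m ^ (t * card X) * (u ^ (u * u) + (m + 1))))"
    using assms(2) small by (intro mult_le_mono crd) auto
  also have "\<dots> = m ^ 2 * m ^ (2 * t * card X) * (u ^ (u * u) + (m + 1))"
    unfolding double by (simp only: power2_eq_square mult.assoc)
  finally show ?thesis using fin small by (auto simp: group_codes_def)
qed

context group
begin

definition small_index_normals :: "nat \<Rightarrow> 'a set set" where
  "small_index_normals m = {N. N \<lhd> G \<and> finite (rcosets N) \<and> card (rcosets N) \<le> m}"

text \<open>Choosing a code for each subgroup is injective by
  \<open>coded_by_unique\<close>.\<close>

lemma card_small_index_normals:
  assumes X: "finite X" "X \<subseteq> carrier G" "m_inv G ` X \<subseteq> X" "generate G X = carrier G"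
    and s: "1 \<le> s" "s * s \<le> m" and u: "\<And>w. w * (w + 1) \<le> 4 * s \<Longrightarrow> s ^ w \<le> u"
  shows "finite (small_index_normals m) \<and> card (small_index_normals m)
    \<le> m ^ 2 * m ^ (2 * (m div s) * card X) * (u ^ (u * u) + (m + 1))"
proof -
  let ?C = "group_codes X (m div s) m u"
  have "\<forall>N\<in>small_index_normals m. \<exists>d. d \<in> ?C \<and> (\<exists>f. coded_by X N d f)"
    using exists_code[OF X(2) _ _ _ s u] unfolding small_index_normals_def by blast
  then obtain D where D: "\<And>N. N \<in> small_index_normals m \<Longrightarrow> D N \<in> ?C \<and> (\<exists>f. coded_by X N (D N) f)"
    by metis
  have "inj_on D (small_index_normals m)"
  proof (rule inj_onI)
    fix N N' assume N: "N \<in> small_index_normals m" "N' \<in> small_index_normals m" and e: "D N = D N'"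
    obtain f f' where "coded_by X N (D N) f" "coded_by X N' (D N) f'" using D N e by metis
    moreover have "N \<subseteq> carrier G" "N' \<subseteq> carrier G"
      using N by (auto simp: small_index_normals_def dest!: normal_imp_subgroup dest: subgroup.mem_carrier)
    ultimately show "N = N'" using coded_by_unique[OF X(2-4)] by blast
  qed
  moreover have "D ` small_index_normals m \<subseteq> ?C" using D by blast
  moreover have "finite ?C" "card ?C \<le> m ^ 2 * m ^ (2 * (m div s) * card X) * (u ^ (u * u) + (m + 1))"
    using card_group_codes[OF X(1) div_le_dividend] by auto
  ultimately show ?thesis
    by (meson card_inj_on_le inj_on_finite le_trans)
qed

section \<open>Growth of balls\<close>

definition word_ball :: "'a set \<Rightarrow> nat \<Rightarrow> 'a set" where
  "word_ball X n = {foldr (\<otimes>) w \<one> | w. set w \<subseteq> X \<and> length w \<le> n}"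

lemma foldr_closed [simp]: "set w \<subseteq> carrier G \<Longrightarrow> foldr (\<otimes>) w \<one> \<in> carrier G"
  by (induction w) auto

lemma foldr_append_mult:
  "\<lbrakk>set v \<subseteq> carrier G; set w \<subseteq> carrier G\<rbrakk>
    \<Longrightarrow> foldr (\<otimes>) (v @ w) \<one> = foldr (\<otimes>) v \<one> \<otimes> foldr (\<otimes>) w \<one>"
  by (induction v) (auto simp: m_assoc)

lemma foldr_rev_inv:
  "set w \<subseteq> carrier G \<Longrightarrow> foldr (\<otimes>) (rev (map (m_inv G) w)) \<one> = inv (foldr (\<otimes>) w \<one>)"
proof (induction w)
  case (Cons a w)
  have "set (rev (map (m_inv G) w)) \<subseteq> carrier G" using Cons.prems by auto
  then have "foldr (\<otimes>) (rev (map (m_inv G) w) @ [inv a]) \<one> = foldr (\<otimes>) (rev (map (m_inv G) w)) \<one> \<otimes> inv a"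
    using Cons.prems by (subst foldr_append_mult) auto
  then show ?case using Cons by (simp add: inv_mult_group)
qed simp

lemma finite_word_ball: "finite X \<Longrightarrow> finite (word_ball X n)"
proof -
  assume "finite X"
  then have "finite ((\<lambda>w. foldr (\<otimes>) w \<one>) ` {w. set w \<subseteq> X \<and> length w \<le> n})"
    using finite_lists_length_le by blast
  moreover have "word_ball X n = (\<lambda>w. foldr (\<otimes>) w \<one>) ` {w. set w \<subseteq> X \<and> length w \<le> n}"
    by (auto simp: word_ball_def)
  ultimately show ?thesis by simp
qed

lemma word_ball_mult:
  assumes "X \<subseteq> carrier G" "a \<in> word_ball X k" "b \<in> word_ball X n"
  shows "a \<otimes> b \<in> word_ball X (k + n)"
proof -
  obtain v w where v: "set v \<subseteq> X" "length v \<le> k" "a = foldr (\<otimes>) v \<one>"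
    and w: "set w \<subseteq> X" "length w \<le> n" "b = foldr (\<otimes>) w \<one>"
    using assms by (auto simp: word_ball_def)
  then have "a \<otimes> b = foldr (\<otimes>) (v @ w) \<one>" using assms(1) by (subst foldr_append_mult) auto
  moreover have "set (v @ w) \<subseteq> X" "length (v @ w) \<le> k + n" using v w by auto
  ultimately show ?thesis unfolding word_ball_def by blast
qed

lemma word_ball_inv:
  assumes "X \<subseteq> carrier G" "m_inv G ` X \<subseteq> X" "a \<in> word_ball X k"
  shows "inv a \<in> word_ball X k"
proof -
  obtain v where v: "set v \<subseteq> X" "length v \<le> k" "a = foldr (\<otimes>) v \<one>"
    using assms by (auto simp: word_ball_def)
  then have "inv a = foldr (\<otimes>) (rev (map (m_inv G) v)) \<one>"
    using assms(1) foldr_rev_inv[of v] by auto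
  moreover have "set (rev (map (m_inv G) v)) \<subseteq> X" "length (rev (map (m_inv G) v)) \<le> k"
    using v assms(2) by auto
  ultimately show ?thesis unfolding word_ball_def by blast
qed

lemma word_ball_subset: "X \<subseteq> carrier G \<Longrightarrow> word_ball X n \<subseteq> carrier G"
  by (auto simp: word_ball_def)

text \<open>Balls grow strictly: if two consecutive balls agreed, the ball would be closed under
  left multiplication by generators, hence be the whole group, which is infinite.\<close>

lemma card_word_ball_ge:
  assumes X: "finite X" "X \<subseteq> carrier G" "m_inv G ` X \<subseteq> X" "generate G X = carrier G"
    and inf: "infinite (carrier G)"
  shows "n < card (word_ball X n)"
proof (induction n)
  case 0
  have "\<one> \<in> word_ball X 0" by (auto simp: word_ball_def)
  then show ?case using finite_word_ball[OF X(1)] by (auto simp: card_gt_0_iff)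
next
  case (Suc n)
  have sub: "word_ball X n \<subseteq> word_ball X (Suc n)" by (fastforce simp: word_ball_def)
  have "word_ball X n \<noteq> word_ball X (Suc n)"
  proof
    assume eq: "word_ball X n = word_ball X (Suc n)"
    have X1: "X \<subseteq> word_ball X 1"
    proof
      fix x assume "x \<in> X"
      then have "x = foldr (\<otimes>) [x] \<one>" "set [x] \<subseteq> X" using X(2) by auto
      moreover have "length [x] \<le> 1" by simp
      ultimately show "x \<in> word_ball X 1" unfolding word_ball_def by blast
    qed
    have step: "x \<otimes> b \<in> word_ball X n" if "x \<in> X" "b \<in> word_ball X n" for x b
      using word_ball_mult[OF X(2), of x 1 b n] X1 that eq by auto
    have "\<forall>b\<in>word_ball X n. g \<otimes> b \<in> word_ball X n" if "g \<in> generate G X" for g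
      using that
    proof (induction g rule: generate.induct)
      case one
      then show ?case using word_ball_subset[OF X(2)] by (simp add: subset_iff)
    next
      case (incl h)
      then show ?case using step by blast
    next
      case (inv h)
      then show ?case using step X(3) by blast
    next
      case (eng h1 h2)
      have "h1 \<in> carrier G" "h2 \<in> carrier G" using eng.hyps X(4) by auto
      then show ?case using eng.IH word_ball_subset[OF X(2)] by (simp add: m_assoc subset_iff)
    qed
    moreover have "\<one> \<in> word_ball X n" by (auto simp: word_ball_def intro!: exI[of _ "[]"])
    ultimately have "g \<in> word_ball X n" if "g \<in> carrier G" for g
      using that X(4) by (metis r_one)
    then show False using inf finite_word_ball[OF X(1)] by (meson finite_subset subsetI)
  qed
  then have "word_ball X n \<subset> word_ball X (Suc n)" using sub by blast
  then have "card (word_ball X n) < card (word_ball X (Suc n))"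
    using finite_word_ball[OF X(1)] psubset_card_mono by blast
  then show ?case using Suc by simp
qed

lemma word_length_le_iff:
  "word_length G S g \<le> enat n \<longleftrightarrow> g \<in> word_ball (S \<union> m_inv G ` S) n"
proof
  assume "g \<in> word_ball (S \<union> m_inv G ` S) n"
  then obtain w where w: "set w \<subseteq> S \<union> m_inv G ` S" "length w \<le> n" "g = foldr (\<otimes>) w \<one>"
    by (auto simp: word_ball_def)
  then have "word_length G S g \<le> enat (length w)"
    unfolding word_length_def by (intro Inf_lower) blast
  also have "\<dots> \<le> enat n" using w by simp
  finally show "word_length G S g \<le> enat n" .
next
  assume le: "word_length G S g \<le> enat n"
  show "g \<in> word_ball (S \<union> m_inv G ` S) n"
  proof (rule ccontr)
    assume "g \<notin> word_ball (S \<union> m_inv G ` S) n"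
    \<comment> \<open>No admissible word has length at most \<open>n\<close>, so
      \<open>Suc n\<close> is a lower bound, also when no word represents \<open>g\<close> and the
      infimum is infinite.\<close>
    then have "enat (Suc n) \<le> word_length G S g"
      unfolding word_length_def word_ball_def
      by (intro Inf_greatest) (auto simp: not_le[symmetric] Suc_le_eq)
    then have "enat (Suc n) \<le> enat n" using le by (rule order_trans)
    then show False by simp
  qed
qed

lemma symmetric_generators:
  assumes "finite S" "S \<subseteq> carrier G" "generate G S = carrier G"
  shows "finite (S \<union> m_inv G ` S)" "S \<union> m_inv G ` S \<subseteq> carrier G"
    "m_inv G ` (S \<union> m_inv G ` S) \<subseteq> S \<union> m_inv G ` S"
    "generate G (S \<union> m_inv G ` S) = carrier G"
proof -
  show "finite (S \<union> m_inv G ` S)" using assms(1) by simp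
  show X: "S \<union> m_inv G ` S \<subseteq> carrier G" using assms(2) by auto
  show "m_inv G ` (S \<union> m_inv G ` S) \<subseteq> S \<union> m_inv G ` S"
    using assms(2) by (auto simp: subset_iff)
  show "generate G (S \<union> m_inv G ` S) = carrier G"
    using assms(3) mono_generate[of S "S \<union> m_inv G ` S"] generate_incl[OF X] by blast
qed

text \<open>Pigeonhole for \<open>g \<mapsto> (N #> g)\<close> over all \<open>N\<close> of index at
  most \<open>m\<close>: there are at most \<open>m ^ T\<close> values but more elements in the ball
  of radius \<open>m ^ T\<close>. The quotient of two colliding elements lies in all these
  \<open>N\<close>.\<close>

lemma normal_farb_growth_gt:
  assumes S: "finite S" "S \<subseteq> carrier G" "generate G S = carrier G"
    and inf: "infinite (carrier G)"
    and T: "finite (small_index_normals m)" "card (small_index_normals m) \<le> T" and m: "1 \<le> m"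
  shows "enat m < normal_farb_growth G S (2 * m ^ T)"
proof -
  let ?X = "S \<union> m_inv G ` S" and ?N = "small_index_normals m" and ?R = "m ^ T"
  note X = symmetric_generators(1-3)[OF S] and gen = symmetric_generators(4)[OF S]
  let ?\<psi> = "\<lambda>g. \<lambda>N\<in>?N. N #> g"
  have "?\<psi> ` word_ball ?X ?R \<subseteq> (\<Pi>\<^sub>E N\<in>?N. rcosets N)"
    using word_ball_subset[OF X(2), of ?R] by (auto simp: RCOSETS_def)
  moreover have fP: "finite (\<Pi>\<^sub>E N\<in>?N. rcosets N)"
    using T(1) by (intro finite_PiE) (auto simp: small_index_normals_def)
  ultimately have "card (?\<psi> ` word_ball ?X ?R) \<le> card (\<Pi>\<^sub>E N\<in>?N. rcosets N)"
    by (intro card_mono)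
  also have "\<dots> = (\<Prod>N\<in>?N. card (rcosets N))" using T(1) by (rule card_PiE)
  also have "\<dots> \<le> (\<Prod>N\<in>?N. m)"
    by (intro prod_mono) (auto simp: small_index_normals_def)
  also have "\<dots> \<le> ?R" using T(2) m by (simp add: power_increasing)
  also have "\<dots> < card (word_ball ?X ?R)" using card_word_ball_ge[OF X gen inf] .
  finally have "\<not> inj_on ?\<psi> (word_ball ?X ?R)" by (rule pigeonhole)
  then obtain a b where ab: "a \<in> word_ball ?X ?R" "b \<in> word_ball ?X ?R" "a \<noteq> b" "?\<psi> a = ?\<psi> b"
    unfolding inj_on_def by blast
  have abG: "a \<in> carrier G" "b \<in> carrier G" using ab word_ball_subset[OF X(2)] by blast+
  let ?g = "a \<otimes> inv b"
  have g1: "?g \<noteq> \<one>" using ab(3) abG by (metis inv_equality inv_inv inv_closed)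
  have "?g \<in> word_ball ?X (2 * ?R)"
    using word_ball_mult[OF X(2) ab(1) word_ball_inv[OF X(2,3) ab(2)]] by (simp add: mult_2)
  then have mem: "?g \<in> punctured_ball G S (2 * ?R)"
    using g1 abG by (simp add: punctured_ball_def word_length_le_iff)
  have inN: "?g \<in> N" if N: "N \<in> ?N" for N
  proof -
    have sg: "subgroup N G" using N by (simp add: small_index_normals_def normal_imp_subgroup)
    have "N #> a = N #> b" using ab(4) N by (metis restrict_apply')
    then have "a \<in> N #> b" using rcos_self[OF abG(1) sg] by simp
    then show ?thesis using subgroup.rcos_module_imp[OF sg is_group abG(2)] by blast
  qed
  have "enat (Suc m) \<le> normal_divisibility G ?g"
    unfolding normal_divisibility_def
  proof (rule Inf_greatest)
    fix z assume "z \<in> {enat (card (rcosets N)) |N. N \<lhd> G \<and> finite (rcosets N) \<and> ?g \<notin> N}"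
    then obtain N where N: "z = enat (card (rcosets N))" "N \<lhd> G" "finite (rcosets N)" "?g \<notin> N" by blast
    then have "\<not> card (rcosets N) \<le> m" using inN by (auto simp: small_index_normals_def)
    then show "enat (Suc m) \<le> z" using N(1) by simp
  qed
  also have "\<dots> \<le> normal_farb_growth G S (2 * ?R)"
  proof -
    have "punctured_ball G S (2 * ?R) \<subseteq> word_ball ?X (2 * ?R)"
      by (auto simp: punctured_ball_def word_length_le_iff)
    then have "finite (punctured_ball G S (2 * ?R))"
      using finite_word_ball[OF X(1)] finite_subset by blast
    then show ?thesis using mem by (auto simp: normal_farb_growth_def)
  qed
  finally show ?thesis by (simp add: Suc_ile_eq)
qed

end

section \<open>Choice of parameters\<close>

text \<open>\<open>C\<close> is the constant of the assumed domination and \<open>r\<close> the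
  number of symmetric generators. Writing \<open>T\<close> for the bound on the number of normal
  subgroups, the last inequality says \<open>ln (C * n) < exp (m / C)\<close> for
  \<open>n = 2 * m ^ T\<close>.\<close>

lemma exists_parameters:
  fixes C :: real and r n0 :: nat
  assumes C: "C > 0"
  obtains m s u :: nat where "1 \<le> m" "n0 \<le> m" "1 \<le> s" "s * s \<le> m"
    "\<And>w. w * (w + 1) \<le> 4 * s \<Longrightarrow> s ^ w \<le> u" "1 < ln (C * real m)"
    "ln (2 * C) + real (m ^ 2 * m ^ (2 * (m div s) * r) * (u ^ (u * u) + (m + 1))) * ln (real m)
       < exp (real m / C)"
proof -
  \<comment> \<open>Since \<open>s \<ge> K * ln m\<close>, the exponent
    \<open>2 * (m div s) * r * ln m\<close> is at most
    \<open>2 * r * m / K \<le> m / (4 * C)\<close>. The summand \<open>1\<close> keeps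
    \<open>K\<close> positive for \<open>r = 0\<close>.\<close>
  define K where "K = 8 * real r * C + 1"
  have K: "K > 0" "8 * real r * C \<le> K" using C by (auto simp: K_def add_nonneg_pos)
  have lim: "\<forall>\<^sub>F m in sequentially. P (real m)" if "\<forall>\<^sub>F x in at_top. P x" for P
    using that filterlim_real_sequentially by (rule eventually_compose_filterlim)
  have "\<forall>\<^sub>F m :: real in at_top.
      (K * ln m + 2) powr (4 * sqrt (K * ln m + 2)) \<le> m powr (1 / 3) - 1"
    using K(1) by real_asymp
  moreover have "\<forall>\<^sub>F m :: real in at_top. (K * ln m + 2)\<^sup>2 \<le> m"
    using K(1) by real_asymp
  moreover have "\<forall>\<^sub>F m :: real in at_top.
      ln (2 * C) + m\<^sup>2 * exp (m / (4 * C)) * (m powr (m powr (2 / 3)) + m + 1) * ln m < exp (m / C)"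
    using C by real_asymp
  moreover have "\<forall>\<^sub>F m :: real in at_top. 1 < ln (C * m)"
    using C by real_asymp
  moreover have "\<forall>\<^sub>F m :: real in at_top. max 2 (real n0) \<le> m"
    by (rule eventually_ge_at_top)
  ultimately have "\<forall>\<^sub>F m :: real in at_top.
      (K * ln m + 2) powr (4 * sqrt (K * ln m + 2)) \<le> m powr (1 / 3) - 1 \<and>
      (K * ln m + 2)\<^sup>2 \<le> m \<and>
      ln (2 * C) + m\<^sup>2 * exp (m / (4 * C)) * (m powr (m powr (2 / 3)) + m + 1) * ln m < exp (m / C) \<and>
      1 < ln (C * m) \<and> max 2 (real n0) \<le> m"
    by eventually_elim auto
  from eventually_happens'[OF sequentially_bot lim[OF this]] obtain m :: nat where
    m1: "(K * ln m + 2) powr (4 * sqrt (K * ln m + 2)) \<le> m powr (1 / 3) - 1"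
    and m2: "(K * ln m + 2)\<^sup>2 \<le> m"
    and m3: "ln (2 * C) + (real m)\<^sup>2 * exp (m / (4 * C)) * (m powr (m powr (2 / 3)) + m + 1) * ln m < exp (m / C)"
    and m4: "1 < ln (C * m)" and m5: "max 2 (real n0) \<le> m"
    by auto
  \<comment> \<open>The \<open>2\<close> absorbs the rounding and the added one in \<open>s\<close>,
    so \<open>s \<le> B\<close>; likewise the \<open>- 1\<close> in \<open>m1\<close> absorbs the
    floor in \<open>u\<close>.\<close>
  define B where "B = K * ln m + 2"
  define s where "s = nat \<lceil>K * ln m\<rceil> + 1"
  define u where "u = nat \<lfloor>m powr (1 / 3)\<rfloor>"
  have mg: "2 \<le> m" "n0 \<le> m" using m5 by auto
  have l0: "0 < ln m" "0 \<le> K * ln m" using mg K(1) by auto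
  have sB: "K * ln m \<le> s" "real s \<le> B" "1 \<le> s"
    using l0(2) by (auto simp: s_def B_def) linarith+
  have "real (s * s) \<le> B\<^sup>2" using sB by (simp add: power2_eq_square mult_mono)
  also have "\<dots> \<le> m" using m2 by (simp add: B_def)
  finally have ss: "s * s \<le> m" by (rule of_nat_le_iff[THEN iffD1])
  have u_le: "real u \<le> m powr (1 / 3)" "m powr (1 / 3) - 1 \<le> real u"
    unfolding u_def by (simp, linarith)
  have su: "s ^ w \<le> u" if w: "w * (w + 1) \<le> 4 * s" for w
  proof -
    have "w * w \<le> 4 * s" using w by simp
    then have "real (w * w) \<le> real (4 * s)" by (rule of_nat_mono)
    then have "(real w)\<^sup>2 \<le> 16 * B" using sB(2,3) by (simp add: power2_eq_square)
    then have "real w \<le> sqrt (16 * B)" by (rule real_le_rsqrt)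
    then have wB: "real w \<le> 4 * sqrt B" by (simp add: real_sqrt_mult)
    have B1: "1 \<le> B" using l0 by (simp add: B_def)
    have "real (s ^ w) \<le> B ^ w" using sB by (simp add: power_mono)
    also have "\<dots> = B powr w" using B1 by (simp add: powr_realpow)
    also have "\<dots> \<le> B powr (4 * sqrt B)" using B1 wB by (intro powr_mono) auto
    also have "\<dots> \<le> u" using m1 u_le(2) by (simp add: B_def)
    finally show ?thesis by simp
  qed
  let ?T = "m ^ 2 * m ^ (2 * (m div s) * r) * (u ^ (u * u) + (m + 1))"
  have T1: "real (m ^ (2 * (m div s) * r)) \<le> exp (m / (4 * C))"
  proof -
    let ?q = "real (m div s)"
    have "?q * (K * ln m) \<le> ?q * s" using sB by (intro mult_left_mono) auto
    also have "\<dots> \<le> m" by (metis of_nat_mult of_nat_mono div_times_less_eq_dividend)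
    finally have "K * (?q * ln m) \<le> m" by (simp add: ac_simps)
    moreover have "8 * real r * C * (?q * ln m) \<le> K * (?q * ln m)"
      using K l0 by (intro mult_right_mono) auto
    ultimately have "2 * ?q * real r * ln m \<le> m / (4 * C)" using C by (simp add: field_simps)
    moreover have "real (m ^ (2 * (m div s) * r)) = exp (real (2 * (m div s) * r) * ln m)"
      using mg by (subst exp_of_nat_mult) simp
    ultimately show ?thesis by simp
  qed
  \<comment> \<open>As \<open>u\<close> is at most the cube root of \<open>m\<close>, the number of
    multiplication tables is \<open>exp(o(m))\<close>.\<close>
  have T2: "real (u ^ (u * u)) \<le> m powr (m powr (2 / 3))"
  proof -
    have "m powr (1 / 3) \<le> m powr 1" using mg by (intro powr_mono) auto
    then have "real u \<le> real m" using u_le(1) mg by simp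
    then have "real (u ^ (u * u)) \<le> real m ^ (u * u)" using mg by (simp add: power_mono)
    also have "\<dots> = m powr (real (u * u))" using mg by (subst powr_realpow) auto
    also have "\<dots> \<le> m powr (m powr (2 / 3))"
    proof (rule powr_mono)
      have "real (u * u) \<le> m powr (1 / 3) * m powr (1 / 3)"
        using u_le(1) by (simp add: mult_mono)
      also have "\<dots> = m powr (2 / 3)" by (simp add: powr_add[symmetric])
      finally show "real (u * u) \<le> m powr (2 / 3)" .
    qed (use mg in auto)
    finally show ?thesis .
  qed
  have "real ?T = (real m)\<^sup>2 * real (m ^ (2 * (m div s) * r)) * (real (u ^ (u * u)) + (real m + 1))"
    by (simp only: of_nat_mult of_nat_add of_nat_power of_nat_1)
  also have "\<dots> \<le> (real m)\<^sup>2 * exp (m / (4 * C)) * (m powr (m powr (2 / 3)) + (real m + 1))"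
    using T1 T2 by (intro mult_mono add_mono) auto
  finally have "real ?T * ln m \<le> (real m)\<^sup>2 * exp (m / (4 * C)) * (m powr (m powr (2 / 3)) + real m + 1) * ln m"
    using l0 by (intro mult_right_mono) (auto simp: add.assoc)
  then have "ln (2 * C) + real ?T * ln m < exp (m / C)" using m3 by linarith
  then show ?thesis using mg sB(3) ss su m4 by (intro that) auto
qed

text \<open>At \<open>n = 2 * m ^ T\<close> the growth exceeds \<open>m\<close>, whereas the
  parameters make \<open>C * ln (ln (C * n))\<close> smaller than \<open>m\<close>.\<close>

theorem theorem1p3:
  fixes G :: "('a, 'b) monoid_scheme" and S :: "'a set"
  assumes "group G"
    and "finite S" and "S \<subseteq> carrier G" and "generate G S = carrier G"
    and "(\<lambda>n. ereal_of_enat (normal_farb_growth G S n)) \<preceq>\<^sub>g (\<lambda>x. ereal (ln (ln x)))"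
  shows "finite (carrier G)"
proof (rule ccontr)
  assume inf: "infinite (carrier G)"
  interpret group G by (rule assms(1))
  let ?X = "S \<union> m_inv G ` S"
  note X = symmetric_generators(1-3)[OF assms(2-4)] and gen = symmetric_generators(4)[OF assms(2-4)]
  obtain C n0 where C: "C > 0" and dom: "\<And>n. n \<ge> n0 \<Longrightarrow>
      ereal_of_enat (normal_farb_growth G S n) \<le> ereal C * ereal (ln (ln (C * real n)))"
    using assms(5) unfolding growth_dominated_def eventually_sequentially by blast
  obtain m s u where m: "1 \<le> m" "n0 \<le> m" and s: "1 \<le> s" "s * s \<le> m"
    and u: "\<And>w. w * (w + 1) \<le> 4 * s \<Longrightarrow> s ^ w \<le> u" and lnCm: "1 < ln (C * real m)"
    and T: "ln (2 * C) + real (m ^ 2 * m ^ (2 * (m div s) * card ?X) * (u ^ (u * u) + (m + 1))) * ln (real m)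
       < exp (real m / C)"
    using exists_parameters[OF C, where r = "card ?X" and ?n0.0 = n0] by metis
  define T where "T = m ^ 2 * m ^ (2 * (m div s) * card ?X) * (u ^ (u * u) + (m + 1))"
  have "finite (small_index_normals m)" "card (small_index_normals m) \<le> T"
    using card_small_index_normals[OF X gen s u] by (auto simp: T_def)
  then have gt: "enat m < normal_farb_growth G S (2 * m ^ T)"
    using normal_farb_growth_gt[OF assms(2-4) inf] m(1) by blast
  let ?n = "2 * m ^ T"
  \<comment> \<open>A positive \<open>T\<close> yields \<open>m \<le> ?n\<close>. This puts
    \<open>?n\<close> beyond \<open>n0\<close> and carries \<open>1 < ln (C * m)\<close> over to
    \<open>?n\<close>, so that the outer logarithm has a positive argument.\<close>
  have "1 \<le> T" using m(1) by (simp add: T_def Suc_le_eq)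
  then have "m ^ 1 \<le> m ^ T" using m(1) by (rule power_increasing)
  then have mn: "m \<le> ?n" by simp
  have "C * real m \<le> C * real ?n" using C mn by (intro mult_left_mono of_nat_mono) auto
  moreover have "0 < C * real m" using C m(1) by simp
  ultimately have ln1: "1 < ln (C * real ?n)" using lnCm by (smt (verit) ln_le_cancel_iff)
  have "C * real ?n = (2 * C) * real m ^ T" by simp
  then have "ln (C * real ?n) = ln (2 * C) + real T * ln (real m)"
    using C m(1) by (simp add: ln_mult ln_realpow del: mult_numeral_left_semiring_numeral)
  also have "\<dots> < exp (real m / C)" using T by (simp add: T_def)
  finally have "ln (ln (C * real ?n)) < ln (exp (real m / C))" using ln1 by (subst ln_less_cancel_iff) auto
  then have "C * ln (ln (C * real ?n)) < real m" using C by (simp add: field_simps)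
  moreover have "ereal (real m) < ereal_of_enat (normal_farb_growth G S ?n)"
    using gt by (metis ereal_of_enat_less_iff ereal_of_enat_simps(1))
  moreover have "ereal_of_enat (normal_farb_growth G S ?n) \<le> ereal (C * ln (ln (C * real ?n)))"
    using dom[of ?n] mn m(2) by simp
  ultimately show False by (meson ereal_less_eq(3) less_le_trans not_le order_less_imp_le leD)
qed

end
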